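(* Let $\mathbb{K}=\mathbb{C}$, let $d\ge 2$, $n\ge 3$ and $0\le a_1,\dots,a_n\le d-1$ be integers, let $M_{a_1,\dots,a_n}$ be the corresponding diagonal representation of the cyclic group $\mathbb{Z}/d\mathbb{Z}$, and let $I\subset S=\mathbb{K}[x_1,\dots,x_n]$ be the ideal generated by all forms of degree $d$ fixed by the action of $M_{a_1,\dots,a_n}$. Then $S/I$ satisfies the weak Lefschetz property if and only if at least $n-1$ of the integers $a_1,\dots,a_n$ are equal.
   Context: Let $\xi=e^{2\pi i/d}$. $M_{a_1,\dots,a_n}$ is the diagonal matrix $\mathrm{diag}(\xi^{a_1},\dots,\xi^{a_n})$; it defines an action of $\mathbb{Z}/d\mathbb{Z}$ on $S$ by $x_i\mapsto \xi^{a_i}x_i$. A form (homogeneous polynomial) is fixed if it is invariant under this action. The ideal $I$ is artinian, since $x_1^d,\dots,x_n^d\in I$. For a homogeneous artinian ideal $I$, $S/I$ has the weak Lefschetz property (WLP) if there is a linear form $\ell\in (S/I)_1$ such that for all integers $j$ the multiplication map $\times\ell:(S/I)_j\to(S/I)_{j+1}$ is injective or surjective. *)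

theory Defs
  imports
    "HOL-Analysis.Analysis"
    "HOL-Algebra.QuotRing"
    "HOL-Algebra.Algebraic_Closure_Type"
    "HOL-Library.Poly_Mapping"
begin

text \<open>
  Polynomials over the complex numbers in variables indexed by a finite type, so that the number
  of variables is the cardinality of that type. A polynomial maps exponent vectors to
  coefficients, and the ring operations are those of \<^theory>\<open>HOL-Library.Poly_Mapping\<close>.
\<close>

type_synonym 'n cpoly = "('n \<Rightarrow>\<^sub>0 nat) \<Rightarrow>\<^sub>0 complex"

definition Const :: "complex \<Rightarrow> 'n cpoly" where
  "Const c = Poly_Mapping.single 0 c"

definition Var :: "'n \<Rightarrow> 'n cpoly" where
  "Var i = Poly_Mapping.single (Poly_Mapping.single i 1) 1"

definition mon_degree :: "('n::finite \<Rightarrow>\<^sub>0 nat) \<Rightarrow> nat" where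
  "mon_degree m = (\<Sum>i\<in>UNIV. Poly_Mapping.lookup m i)"

text \<open>
  Degrees of forms are integers, so the zero polynomial is the only form of negative degree. It is
  a form of every degree.
\<close>

definition homogeneous :: "int \<Rightarrow> ('n::finite) cpoly \<Rightarrow> bool" where
  "homogeneous j f \<longleftrightarrow> (\<forall>m\<in>Poly_Mapping.keys f. int (mon_degree m) = j)"

definition poly_subst :: "('n::finite \<Rightarrow> 'n cpoly) \<Rightarrow> 'n cpoly \<Rightarrow> 'n cpoly" where
  "poly_subst \<phi> f =
     (\<Sum>m\<in>Poly_Mapping.keys f.
        Const (Poly_Mapping.lookup f m) * (\<Prod>i\<in>UNIV. \<phi> i ^ Poly_Mapping.lookup m i))"

definition mat_action :: "complex ^ 'n ^ 'n \<Rightarrow> ('n::finite) cpoly \<Rightarrow> 'n cpoly" where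
  "mat_action A = poly_subst (\<lambda>i. \<Sum>j\<in>UNIV. Const (A $ i $ j) * Var j)"

definition prim_root :: "nat \<Rightarrow> complex" where
  "prim_root d = exp (2 * complex_of_real pi * \<i> / of_nat d)"

text \<open>
  The matrix by which the residue class of \<open>k\<close> modulo \<open>d\<close> acts. The case \<open>k = 1\<close> is
  the matrix usually written \<open>M\<close> with indices \<open>a\<close>, and the others are its powers.
\<close>

definition diag_rep :: "nat \<Rightarrow> ('n::finite \<Rightarrow> nat) \<Rightarrow> nat \<Rightarrow> complex ^ 'n ^ 'n" where
  "diag_rep d a k = (\<chi> i j. if i = j then (prim_root d ^ a i) ^ k else 0)"

definition fixed_poly :: "nat \<Rightarrow> ('n::finite \<Rightarrow> nat) \<Rightarrow> 'n cpoly \<Rightarrow> bool" where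
  "fixed_poly d a f \<longleftrightarrow> (\<forall>k<d. mat_action (diag_rep d a k) f = f)"

abbreviation poly_ring :: "('n::finite) cpoly ring" where
  "poly_ring \<equiv> ring_of_type_algebra"

definition fixed_forms_ideal :: "nat \<Rightarrow> ('n::finite \<Rightarrow> nat) \<Rightarrow> 'n cpoly set" where
  "fixed_forms_ideal d a = Idl\<^bsub>poly_ring\<^esub> {f. homogeneous (int d) f \<and> fixed_poly d a f}"

definition quot_component :: "('n::finite) cpoly set \<Rightarrow> int \<Rightarrow> 'n cpoly set set" where
  "quot_component I j = (\<lambda>f. I +>\<^bsub>poly_ring\<^esub> f) ` {f. homogeneous j f}"

text \<open>Only meaningful for homogeneous artinian ideals \<open>I\<close>.\<close>

definition weak_Lefschetz :: "('n::finite) cpoly set \<Rightarrow> bool" where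
  "weak_Lefschetz I \<longleftrightarrow>
     (\<exists>l\<in>quot_component I 1. \<forall>j.
        inj_on (\<lambda>x. l \<otimes>\<^bsub>poly_ring Quot I\<^esub> x) (quot_component I j) \<or>
        (\<lambda>x. l \<otimes>\<^bsub>poly_ring Quot I\<^esub> x) ` quot_component I j = quot_component I (j + 1))"

end

theory Submission
  imports Defs
begin

text \<open>Let \<open>g\<close> generate the action and let \<open>l\<close> be a nonzero linear form. The product of the \<open>d\<close>
  translates of \<open>l\<close> is a fixed form of degree \<open>d\<close>, so multiplication by \<open>l\<close> is not injective from
  degree \<open>d - 1\<close> to degree \<open>d\<close>. It is surjective there only if every form of degree \<open>d\<close> agrees
  with a fixed form on the hyperplane \<open>l = 0\<close>. That is impossible if the hyperplane contains \<open>p\<close> and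
  \<open>g p\<close> for some \<open>p\<close> that is not an eigenvector of \<open>g\<close>, because fixed forms do not separate these
  points, or if it contains a coordinate point at which the derivatives of all fixed forms vanish along
  a line in the hyperplane. If no \<open>n - 1\<close> of the weights are equal, one of the two occurs for every
  \<open>l\<close>. If all weights except that of \<open>x\<close> are equal, the ideal contains every form of degree \<open>d\<close> in the
  other variables, and \<open>l = x\<close> works.\<close>

section \<open>Monomials and homogeneous polynomials\<close>

lemma mon_degree_zero [simp]: "mon_degree 0 = 0"
  by (simp add: mon_degree_def)

lemma mon_degree_add [simp]: "mon_degree (m + m') = mon_degree m + mon_degree m'"
  by (simp add: mon_degree_def lookup_add sum.distrib)

lemma mon_degree_single [simp]: "mon_degree (Poly_Mapping.single i k) = k"
  by (simp add: mon_degree_def lookup_single when_def)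

lemma monomial_split:
  assumes "Poly_Mapping.lookup m i \<noteq> (0::nat)"
  obtains m' where "m = Poly_Mapping.single i 1 + m'"
proof
  show "m = Poly_Mapping.single i 1 + (m - Poly_Mapping.single i 1)"
    using assms by (intro poly_mapping_eqI) (auto simp: lookup_add lookup_minus lookup_single when_def)
qed

lemma monomial_split_degree:
  assumes "0 < mon_degree m"
  obtains i m' where "m = Poly_Mapping.single i 1 + m'"
proof -
  obtain i where "Poly_Mapping.lookup m i \<noteq> 0"
    using assms unfolding mon_degree_def by (metis less_irrefl sum.neutral)
  then show thesis
    using monomial_split that by metis
qed

lemma monomial_eq_sum_singles:
  fixes m :: "'n::finite \<Rightarrow>\<^sub>0 nat"
  shows "(\<Sum>i\<in>UNIV. Poly_Mapping.single i (Poly_Mapping.lookup m i)) = m"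
  by (rule poly_mapping_eqI) (simp add: lookup_sum lookup_single when_def)

lemma single_one_eq_iff [simp]:
  "Poly_Mapping.single i (Suc 0) = Poly_Mapping.single j (Suc 0) \<longleftrightarrow> i = j"
  by (metis lookup_single_eq lookup_single_not_eq nat.distinct(1))

lemma monomial_degree_one:
  assumes "mon_degree m = 1"
  obtains i where "m = Poly_Mapping.single i 1"
proof -
  obtain i m' where m: "m = Poly_Mapping.single i 1 + m'"
    using assms monomial_split_degree [of m] by auto
  then have "mon_degree m' = 0"
    using assms by simp
  then have "m' = 0"
    by (intro poly_mapping_eqI) (simp add: mon_degree_def)
  then show thesis
    using m that by simp
qed

lemma homogeneous_zero [simp]: "homogeneous j 0"
  by (simp add: homogeneous_def)

lemma homogeneous_one [simp]: "homogeneous 0 1"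
  by (simp add: homogeneous_def)

lemma homogeneous_single: "int (mon_degree m) = j \<Longrightarrow> homogeneous j (Poly_Mapping.single m c)"
  by (simp add: homogeneous_def)

lemma homogeneous_add: "homogeneous j f \<Longrightarrow> homogeneous j g \<Longrightarrow> homogeneous j (f + g)"
  unfolding homogeneous_def using keys_add [of f g] by blast

lemma homogeneous_uminus: "homogeneous j f \<Longrightarrow> homogeneous j (- f)"
  by (simp add: homogeneous_def in_keys_iff)

lemma homogeneous_diff: "homogeneous j f \<Longrightarrow> homogeneous j g \<Longrightarrow> homogeneous j (f - g)"
  using homogeneous_add [of j f "- g"] homogeneous_uminus [of j g] by simp

lemma homogeneous_sum: "(\<And>x. x \<in> A \<Longrightarrow> homogeneous j (f x)) \<Longrightarrow> homogeneous j (sum f A)"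
  by (induction A rule: infinite_finite_induct) (auto intro: homogeneous_add)

lemma homogeneous_mult:
  assumes "homogeneous j f" "homogeneous k g"
  shows "homogeneous (j + k) (f * g)"
  using assms keys_mult [of f g] by (fastforce simp: homogeneous_def)

lemma homogeneous_prod:
  assumes "\<And>x. x \<in> A \<Longrightarrow> homogeneous 1 (f x)" "finite A"
  shows "homogeneous (int (card A)) (prod f A)"
  using assms(2,1)
proof (induction rule: finite_induct)
  case (insert x A)
  then show ?case
    using homogeneous_mult [of 1 "f x" "int (card A)" "prod f A"] by simp
qed simp

lemma homogeneous_power: "homogeneous 1 f \<Longrightarrow> homogeneous (int k) (f ^ k)"
  using homogeneous_prod [of "{..<k}" "\<lambda>_. f"] by simp

lemma sum_monomials:
  fixes f :: "'n::finite cpoly"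
  shows "(\<Sum>m\<in>Poly_Mapping.keys f. Poly_Mapping.single m (Poly_Mapping.lookup f m)) = f"
  by (rule poly_mapping_eqI) (simp add: lookup_sum lookup_single when_def in_keys_iff)

lemma lookup_single_mult:
  fixes f :: "'n::finite cpoly"
  shows "Poly_Mapping.lookup (Poly_Mapping.single k c * f) (k + m) = c * Poly_Mapping.lookup f m"
proof -
  have "Poly_Mapping.single k c * f =
    (\<Sum>m\<in>Poly_Mapping.keys f. Poly_Mapping.single (k + m) (c * Poly_Mapping.lookup f m))"
    by (subst sum_monomials [of f, symmetric]) (simp add: sum_distrib_left mult_single)
  then show ?thesis
    by (simp add: lookup_sum lookup_single when_def in_keys_iff)
qed

lemma lookup_single_mult_0:
  fixes f :: "'n::finite cpoly"
  assumes "\<And>m'. m \<noteq> k + m'"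
  shows "Poly_Mapping.lookup (Poly_Mapping.single k c * f) m = 0"
proof -
  have "m \<notin> Poly_Mapping.keys (Poly_Mapping.single k c * f)"
    using keys_mult [of "Poly_Mapping.single k c" f] assms by (auto split: if_splits)
  then show ?thesis
    by (simp add: in_keys_iff)
qed

section \<open>Substitution\<close>

lemma Const_0 [simp]: "Const 0 = 0"
  by (simp add: Const_def)

lemma Const_1 [simp]: "Const 1 = 1"
  by (simp add: Const_def)

lemma Const_add: "Const (c + c') = Const c + Const c'"
  by (simp add: Const_def single_add)

lemma Const_mult: "Const (c * c') = Const c * Const c'"
  by (simp add: Const_def mult_single)

lemma Const_power: "Const (c ^ k) = Const c ^ k"
  by (induction k) (simp_all add: Const_mult)

lemma Const_sum: "Const (sum f A) = (\<Sum>x\<in>A. Const (f x))"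
  by (induction A rule: infinite_finite_induct) (simp_all add: Const_add)

lemma Const_prod: "Const (prod f A) = (\<Prod>x\<in>A. Const (f x))"
  by (induction A rule: infinite_finite_induct) (simp_all add: Const_mult)

lemma Const_eq_0_iff [simp]: "Const c = 0 \<longleftrightarrow> c = 0"
  by (metis Const_0 Const_def lookup_single_eq lookup_zero)

text \<open>Enlarging the index set adds only zero terms. This allows sums over the different
  supports of \<open>f\<close>, \<open>g\<close> and \<open>f + g\<close> to be compared.\<close>

lemma poly_subst_superset:
  assumes "finite A" "Poly_Mapping.keys f \<subseteq> A"
  shows "poly_subst \<phi> f =
    (\<Sum>m\<in>A. Const (Poly_Mapping.lookup f m) * (\<Prod>i\<in>UNIV. \<phi> i ^ Poly_Mapping.lookup m i))"
  unfolding poly_subst_def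
  by (rule sum.mono_neutral_left) (use assms in \<open>auto simp: in_keys_iff\<close>)

lemma poly_subst_single:
  "poly_subst \<phi> (Poly_Mapping.single m c) =
     Const c * (\<Prod>i\<in>UNIV. \<phi> i ^ Poly_Mapping.lookup m i)"
  using poly_subst_superset [of "{m}" "Poly_Mapping.single m c" \<phi>] by simp

lemma poly_subst_0 [simp]: "poly_subst \<phi> 0 = 0"
  by (simp add: poly_subst_def)

lemma poly_subst_1 [simp]: "poly_subst \<phi> 1 = 1"
  using poly_subst_single [of \<phi> 0 1] by simp

lemma poly_subst_add: "poly_subst \<phi> (f + g) = poly_subst \<phi> f + poly_subst \<phi> g"
proof -
  let ?A = "Poly_Mapping.keys f \<union> Poly_Mapping.keys g"
  have "poly_subst \<phi> h =
    (\<Sum>m\<in>?A. Const (Poly_Mapping.lookup h m) * (\<Prod>i\<in>UNIV. \<phi> i ^ Poly_Mapping.lookup m i))"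
    if "Poly_Mapping.keys h \<subseteq> ?A" for h
    using that by (intro poly_subst_superset) auto
  then show ?thesis
    using keys_add [of f g]
    by (simp add: lookup_add Const_add distrib_right sum.distrib)
qed

lemma poly_subst_sum: "poly_subst \<phi> (sum f A) = (\<Sum>x\<in>A. poly_subst \<phi> (f x))"
  by (induction A rule: infinite_finite_induct) (simp_all add: poly_subst_add)

lemma poly_subst_mult: "poly_subst \<phi> (f * g) = poly_subst \<phi> f * poly_subst \<phi> g"
proof -
  \<comment> \<open>Both sides are additive in each factor, so it suffices to treat
    monomials.\<close>
  have "poly_subst \<phi> (Poly_Mapping.single m c * Poly_Mapping.single m' c') =
    poly_subst \<phi> (Poly_Mapping.single m c) * poly_subst \<phi> (Poly_Mapping.single m' c')" for m m' c c'
    by (simp add: mult_single poly_subst_single Const_mult lookup_add power_add prod.distrib ac_simps)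
  then have "poly_subst \<phi> ((\<Sum>m\<in>Poly_Mapping.keys f. Poly_Mapping.single m (Poly_Mapping.lookup f m)) *
      (\<Sum>m\<in>Poly_Mapping.keys g. Poly_Mapping.single m (Poly_Mapping.lookup g m))) =
    poly_subst \<phi> (\<Sum>m\<in>Poly_Mapping.keys f. Poly_Mapping.single m (Poly_Mapping.lookup f m)) *
    poly_subst \<phi> (\<Sum>m\<in>Poly_Mapping.keys g. Poly_Mapping.single m (Poly_Mapping.lookup g m))"
    by (simp add: sum_product poly_subst_sum)
  then show ?thesis
    by (simp add: sum_monomials)
qed

lemma poly_subst_prod: "poly_subst \<phi> (prod f A) = (\<Prod>x\<in>A. poly_subst \<phi> (f x))"
  by (induction A rule: infinite_finite_induct) (simp_all add: poly_subst_mult)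

lemma poly_subst_power: "poly_subst \<phi> (f ^ k) = poly_subst \<phi> f ^ k"
  by (induction k) (simp_all add: poly_subst_mult)

section \<open>Linear forms and the diagonal action\<close>

definition linear_form :: "('n::finite \<Rightarrow> complex) \<Rightarrow> 'n cpoly" where
  "linear_form c = (\<Sum>i\<in>UNIV. Poly_Mapping.single (Poly_Mapping.single i 1) (c i))"

lemma homogeneous_linear_form: "homogeneous 1 (linear_form c)"
  unfolding linear_form_def by (intro homogeneous_sum homogeneous_single) simp

lemma linear_form_exists:
  assumes "homogeneous 1 L"
  obtains c where "L = linear_form c"
proof
  show "L = linear_form (\<lambda>i. Poly_Mapping.lookup L (Poly_Mapping.single i 1))"
  proof (rule poly_mapping_eqI)
    fix m
    show "Poly_Mapping.lookup L m = Poly_Mapping.lookup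
      (linear_form (\<lambda>i. Poly_Mapping.lookup L (Poly_Mapping.single i 1))) m"
    proof (cases "mon_degree m = 1")
      case True
      then obtain i where "m = Poly_Mapping.single i 1"
        by (rule monomial_degree_one)
      then show ?thesis
        by (simp add: linear_form_def lookup_sum lookup_single when_def)
    next
      case False
      then have "m \<notin> Poly_Mapping.keys f" if "homogeneous 1 f" for f :: "'a cpoly"
        using that by (auto simp: homogeneous_def)
      then show ?thesis
        using assms homogeneous_linear_form by (metis in_keys_iff)
    qed
  qed
qed

lemma linear_form_eq_0: "(\<And>i. c i = 0) \<Longrightarrow> linear_form c = 0"
  by (simp add: linear_form_def)

lemma prod_single_power:
  fixes \<phi> :: "'n::finite \<Rightarrow> 'a::comm_monoid_mult"
  shows "(\<Prod>i\<in>UNIV. \<phi> i ^ Poly_Mapping.lookup (Poly_Mapping.single j k) i) = \<phi> j ^ k"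
  by (simp add: lookup_single when_def if_distrib [of "\<lambda>e. _ ^ e"] cong: if_cong)

lemma poly_subst_Var:
  "poly_subst \<phi> (Poly_Mapping.single (Poly_Mapping.single i 1) c) = Const c * \<phi> i"
  by (simp add: poly_subst_single prod_single_power)

lemma poly_subst_linear_form: "poly_subst \<phi> (linear_form c) = (\<Sum>i\<in>UNIV. Const (c i) * \<phi> i)"
  by (simp only: linear_form_def poly_subst_sum poly_subst_Var)

text \<open>Substituting constants is evaluation at the point \<open>p\<close>, with the value kept
  as a constant polynomial. This way evaluation inherits all the rules for
  \<open>poly_subst\<close>.\<close>

lemma eval_linear_form:
  "poly_subst (\<lambda>i. Const (p i)) (linear_form c) = Const (\<Sum>i\<in>UNIV. c i * p i)"
  by (simp add: poly_subst_linear_form Const_sum Const_mult)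

lemma single_power: "Poly_Mapping.single (Poly_Mapping.single i 1) c ^ k =
  Poly_Mapping.single (Poly_Mapping.single i k) (c ^ k :: complex)"
  by (induction k) (simp_all add: mult_single single_add [symmetric])

lemma prod_single:
  "(\<Prod>x\<in>A. Poly_Mapping.single (k x) (c x)) = Poly_Mapping.single (\<Sum>x\<in>A. k x) (\<Prod>x\<in>A. c x)"
  for c :: "'x \<Rightarrow> complex" and k :: "'x \<Rightarrow> 'n \<Rightarrow>\<^sub>0 nat"
  by (induction A rule: infinite_finite_induct) (simp_all add: mult_single)

text \<open>Monomials are eigenvectors of a diagonal substitution, so no coefficients get
  mixed.\<close>

lemma lookup_diagonal_subst:
  fixes f :: "'n::finite cpoly"
  shows "Poly_Mapping.lookup
      (poly_subst (\<lambda>i. Poly_Mapping.single (Poly_Mapping.single i 1) (w i)) f) m =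
    Poly_Mapping.lookup f m * (\<Prod>i\<in>UNIV. w i ^ Poly_Mapping.lookup m i)"
proof -
  have "poly_subst (\<lambda>i. Poly_Mapping.single (Poly_Mapping.single i 1) (w i)) f =
    (\<Sum>m\<in>Poly_Mapping.keys f. Poly_Mapping.single m
      (Poly_Mapping.lookup f m * (\<Prod>i\<in>UNIV. w i ^ Poly_Mapping.lookup m i)))"
    unfolding poly_subst_def single_power prod_single monomial_eq_sum_singles Const_def mult_single
    by simp
  then show ?thesis
    by (simp add: lookup_sum lookup_single when_def in_keys_iff)
qed

lemma mat_action_diag_rep:
  "mat_action (diag_rep d a k) =
   poly_subst (\<lambda>i. Poly_Mapping.single (Poly_Mapping.single i 1) ((prim_root d ^ a i) ^ k))"
proof -
  have "(\<Sum>j\<in>UNIV. Const (diag_rep d a k $ i $ j) * Var j) =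
    Poly_Mapping.single (Poly_Mapping.single i 1) ((prim_root d ^ a i) ^ k)" for i :: 'a
  proof -
    have "(\<Sum>j\<in>UNIV. Const (diag_rep d a k $ i $ j) * Var j) =
      (\<Sum>j\<in>UNIV. if i = j then Const ((prim_root d ^ a i) ^ k) * Var j else 0)"
      by (intro sum.cong) (auto simp: diag_rep_def)
    then show ?thesis
      by (simp add: Const_def Var_def mult_single)
  qed
  then show ?thesis
    by (simp only: mat_action_def)
qed

text \<open>The generator of the group multiplies the monomial \<open>m\<close> by
  \<open>prim_root d ^ weight a m\<close>. Only the residue modulo \<open>d\<close> matters for the
  action.\<close>

definition weight :: "('n::finite \<Rightarrow> nat) \<Rightarrow> ('n \<Rightarrow>\<^sub>0 nat) \<Rightarrow> nat" where
  "weight a m = (\<Sum>i\<in>UNIV. a i * Poly_Mapping.lookup m i)"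

lemma weight_add [simp]: "weight a (m + m') = weight a m + weight a m'"
  by (simp add: weight_def lookup_add distrib_left sum.distrib)

lemma weight_single [simp]: "weight a (Poly_Mapping.single i k) = a i * k"
  by (simp add: weight_def lookup_single when_def if_distrib cong: if_cong)

lemma prim_root_power_eq_iff:
  assumes "d \<ge> 1"
  shows "prim_root d ^ j = prim_root d ^ k \<longleftrightarrow> j mod d = k mod d"
proof -
  have "prim_root d ^ j = exp (2 * of_real pi * \<i> * of_nat j / of_nat d)" for j
    by (simp add: prim_root_def flip: exp_of_nat_mult) (simp add: algebra_simps)
  then show ?thesis
    using complex_root_unity_eq [OF assms, of j k] by simp
qed

lemma prim_root_power_eq_1_iff: "d \<ge> 1 \<Longrightarrow> prim_root d ^ j = 1 \<longleftrightarrow> d dvd j"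
  using prim_root_power_eq_iff [of d j 0] by (simp add: mod_eq_0_iff_dvd)

lemma prod_prim_root_powers:
  "(\<Prod>i\<in>UNIV. ((prim_root d ^ a i) ^ k) ^ Poly_Mapping.lookup m i) = (prim_root d ^ weight a m) ^ k"
  by (simp add: weight_def power_sum prod_power_distrib flip: power_mult) (simp add: ac_simps)

text \<open>Comparing coefficients, every monomial that occurs must have eigenvalue 1. Invariance
  under the generator alone is assumed, which is the form in which it arises for the product of
  translates.\<close>

lemma weight_of_fixed:
  assumes "d \<ge> 1" "mat_action (diag_rep d a 1) f = f" "m \<in> Poly_Mapping.keys f"
  shows "d dvd weight a m"
proof -
  have "Poly_Mapping.lookup f m * prim_root d ^ weight a m = Poly_Mapping.lookup f m"
    using lookup_diagonal_subst [of "\<lambda>i. (prim_root d ^ a i) ^ 1" f m] assms(2)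
    unfolding mat_action_diag_rep prod_prim_root_powers by simp
  then show ?thesis
    using assms by (simp add: in_keys_iff prim_root_power_eq_1_iff)
qed

lemma fixed_poly_iff:
  assumes "d \<ge> 2"
  shows "fixed_poly d a f \<longleftrightarrow> (\<forall>m\<in>Poly_Mapping.keys f. d dvd weight a m)"
proof
  assume "fixed_poly d a f"
  then have "mat_action (diag_rep d a 1) f = f"
    using assms by (simp add: fixed_poly_def)
  then show "\<forall>m\<in>Poly_Mapping.keys f. d dvd weight a m"
    using assms weight_of_fixed [of d a f] by simp
next
  assume *: "\<forall>m\<in>Poly_Mapping.keys f. d dvd weight a m"
  have "Poly_Mapping.lookup (mat_action (diag_rep d a k) f) m = Poly_Mapping.lookup f m" for k m
  proof (cases "m \<in> Poly_Mapping.keys f")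
    case True
    then have "prim_root d ^ weight a m = 1"
      using * assms prim_root_power_eq_1_iff by simp
    then show ?thesis
      unfolding mat_action_diag_rep lookup_diagonal_subst prod_prim_root_powers by simp
  next
    case False
    then show ?thesis
      unfolding mat_action_diag_rep lookup_diagonal_subst by (simp add: in_keys_iff)
  qed
  then show "fixed_poly d a f"
    by (simp add: fixed_poly_def poly_mapping_eqI)
qed

section \<open>Ideals and the weak Lefschetz property\<close>

lemma poly_ring_simps [simp]:
  "carrier poly_ring = UNIV" "f \<otimes>\<^bsub>poly_ring\<^esub> g = f * g"
  "f \<oplus>\<^bsub>poly_ring\<^esub> g = f + g" "\<zero>\<^bsub>poly_ring\<^esub> = 0"
  by (simp_all add: ring_of_type_algebra_def)

lemma a_inv_poly_ring [simp]: "\<ominus>\<^bsub>poly_ring\<^esub> f = - f"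
proof -
  interpret ring "poly_ring :: 'a cpoly ring"
    by (rule ring_from_type_algebra)
  show ?thesis
    by (rule minus_equality) simp_all
qed

lemma ideal_poly_ring_iff:
  "ideal I poly_ring \<longleftrightarrow>
   0 \<in> I \<and> (\<forall>f\<in>I. \<forall>g\<in>I. f + g \<in> I) \<and> (\<forall>f\<in>I. \<forall>h. h * f \<in> I)"
  (is "_ \<longleftrightarrow> ?R")
proof
  assume "ideal I poly_ring"
  then interpret ideal I poly_ring .
  show ?R
    using additive_subgroup.zero_closed [OF is_additive_subgroup]
      additive_subgroup.a_closed [OF is_additive_subgroup] I_l_closed by simp
next
  assume R: ?R
  show "ideal I poly_ring"
  proof (rule idealI)
    show "ring poly_ring"
      by (rule ring_from_type_algebra)
    show "subgroup I (add_monoid poly_ring)"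
    proof (rule subgroup.intro)
      fix f assume "f \<in> I"
      \<comment> \<open>Closure under negation comes from multiplication by the ring element
        \<open>- 1\<close>.\<close>
      then have "- 1 * f \<in> I"
        using R by blast
      then show "inv\<^bsub>add_monoid poly_ring\<^esub> f \<in> I"
        unfolding a_inv_def [symmetric] by simp
    qed (use R in auto)
  qed (use R in \<open>auto simp: mult.commute\<close>)
qed

lemma ideal_sum:
  "ideal I poly_ring \<Longrightarrow> (\<And>x. x \<in> A \<Longrightarrow> f x \<in> I) \<Longrightarrow> sum f A \<in> I"
  by (induction A rule: infinite_finite_induct) (auto simp: ideal_poly_ring_iff)

lemma coset_eq_iff:
  assumes "ideal I poly_ring"
  shows "I +>\<^bsub>poly_ring\<^esub> f = I +>\<^bsub>poly_ring\<^esub> g \<longleftrightarrow> f - g \<in> I"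
proof -
  interpret ring "poly_ring :: 'a cpoly ring"
    by (rule ring_from_type_algebra)
  show ?thesis
    using quotient_eq_iff_same_a_r_cos [OF assms, of f g] by (simp add: a_minus_def)
qed

lemma coset_mult:
  assumes "ideal I poly_ring"
  shows "(I +>\<^bsub>poly_ring\<^esub> f) \<otimes>\<^bsub>poly_ring Quot I\<^esub> (I +>\<^bsub>poly_ring\<^esub> g) =
    I +>\<^bsub>poly_ring\<^esub> (f * g)"
  using ideal.rcoset_mult_add [OF assms, of f g] by (simp add: FactRing_def)

text \<open>Passing to representatives: injectivity on a component means a trivial kernel, since
  differences of forms of degree \<open>j\<close> are again such forms. For surjectivity only one
  inclusion has content, because multiplication by \<open>L\<close> always lands in degree
  \<open>j + 1\<close>.\<close>

lemma weak_Lefschetz_iff: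
  assumes I: "ideal I poly_ring"
  shows "weak_Lefschetz I \<longleftrightarrow>
    (\<exists>L. homogeneous 1 L \<and>
      (\<forall>j. (\<forall>f. homogeneous j f \<longrightarrow> L * f \<in> I \<longrightarrow> f \<in> I) \<or>
           (\<forall>F. homogeneous (j + 1) F \<longrightarrow> (\<exists>h. homogeneous j h \<and> F - L * h \<in> I))))"
proof -
  let ?c = "\<lambda>f. I +>\<^bsub>poly_ring\<^esub> f"
  let ?m = "\<lambda>L x. ?c L \<otimes>\<^bsub>poly_ring Quot I\<^esub> x"
  have inj: "inj_on (?m L) (quot_component I j) \<longleftrightarrow>
    (\<forall>f. homogeneous j f \<longrightarrow> L * f \<in> I \<longrightarrow> f \<in> I)" for L j
  proof
    assume *: "inj_on (?m L) (quot_component I j)"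
    show "\<forall>f. homogeneous j f \<longrightarrow> L * f \<in> I \<longrightarrow> f \<in> I"
    proof (intro allI impI)
      fix f assume "homogeneous j f" "L * f \<in> I"
      then have "?m L (?c f) = ?m L (?c 0)"
        by (simp add: coset_mult coset_eq_iff I)
      moreover have "?c f \<in> quot_component I j" "?c 0 \<in> quot_component I j"
        using \<open>homogeneous j f\<close> by (auto simp: quot_component_def)
      ultimately have "?c f = ?c 0"
        using * by (blast dest: inj_onD)
      then show "f \<in> I"
        by (simp add: coset_eq_iff I)
    qed
  next
    assume *: "\<forall>f. homogeneous j f \<longrightarrow> L * f \<in> I \<longrightarrow> f \<in> I"
    show "inj_on (?m L) (quot_component I j)"
    proof (rule inj_onI)
      fix x y assume "x \<in> quot_component I j" "y \<in> quot_component I j" and eq: "?m L x = ?m L y"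
      then obtain f g where fg: "homogeneous j f" "homogeneous j g" "x = ?c f" "y = ?c g"
        by (auto simp: quot_component_def)
      then have "L * (f - g) \<in> I"
        using eq by (simp add: coset_mult coset_eq_iff I right_diff_distrib)
      then have "f - g \<in> I"
        using * fg homogeneous_diff by blast
      then show "x = y"
        by (simp add: fg coset_eq_iff I)
    qed
  qed
  have surj: "?m L ` quot_component I j = quot_component I (j + 1) \<longleftrightarrow>
    (\<forall>F. homogeneous (j + 1) F \<longrightarrow> (\<exists>h. homogeneous j h \<and> F - L * h \<in> I))"
    if "homogeneous 1 L" for L j
  proof -
    have image: "?m L ` quot_component I j = (\<lambda>h. ?c (L * h)) ` {h. homogeneous j h}"
      by (simp add: quot_component_def image_image coset_mult I)
    have "(\<lambda>h. ?c (L * h)) ` {h. homogeneous j h} \<subseteq> quot_component I (j + 1)"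
      using homogeneous_mult [OF that, of j] by (auto simp: quot_component_def add.commute [of j 1])
    moreover have "quot_component I (j + 1) \<subseteq> (\<lambda>h. ?c (L * h)) ` {h. homogeneous j h} \<longleftrightarrow>
      (\<forall>F. homogeneous (j + 1) F \<longrightarrow> (\<exists>h. homogeneous j h \<and> F - L * h \<in> I))"
      by (auto simp: quot_component_def image_subset_iff image_iff coset_eq_iff I)
    ultimately show ?thesis
      unfolding image by (simp only: set_eq_subset simp_thms)
  qed
  have "weak_Lefschetz I \<longleftrightarrow> (\<exists>L. homogeneous 1 L \<and>
    (\<forall>j. inj_on (?m L) (quot_component I j) \<or>
      ?m L ` quot_component I j = quot_component I (j + 1)))"
    by (auto simp: weak_Lefschetz_def quot_component_def [of I 1])
  then show ?thesis
    using inj surj by (simp cong: conj_cong)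
qed

section \<open>The ideal of the fixed forms\<close>

lemma fixed_forms_ideal_ideal: "ideal (fixed_forms_ideal d a) poly_ring"
proof -
  interpret ring "poly_ring :: 'a cpoly ring"
    by (rule ring_from_type_algebra)
  show ?thesis
    unfolding fixed_forms_ideal_def by (rule genideal_ideal) simp
qed

lemma fixed_form_in_ideal:
  assumes "d \<ge> 2" "homogeneous (int d) f" "\<And>m. m \<in> Poly_Mapping.keys f \<Longrightarrow> d dvd weight a m"
  shows "f \<in> fixed_forms_ideal d a"
proof -
  interpret ring "poly_ring :: 'a cpoly ring"
    by (rule ring_from_type_algebra)
  have "f \<in> {f. homogeneous (int d) f \<and> fixed_poly d a f}"
    using assms fixed_poly_iff by blast
  then show ?thesis
    unfolding fixed_forms_ideal_def by (rule subsetD [OF genideal_self, rotated]) simp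
qed

text \<open>The polynomials all of whose monomials satisfy \<open>P\<close> form an ideal that
  contains the generators. Hence the ideal is zero below degree \<open>d\<close>, and its forms of
  degree \<open>d\<close> are fixed.\<close>

lemma keys_fixed_forms_ideal:
  fixes a :: "'n::finite \<Rightarrow> nat"
  assumes "d \<ge> 2" "f \<in> fixed_forms_ideal d a" "m \<in> Poly_Mapping.keys f"
  shows "d \<le> mon_degree m" "mon_degree m = d \<Longrightarrow> d dvd weight a m"
proof -
  interpret ring "poly_ring :: 'n cpoly ring"
    by (rule ring_from_type_algebra)
  define P where "P m \<longleftrightarrow> d \<le> mon_degree m \<and> (mon_degree m = d \<longrightarrow> d dvd weight a m)"
    for m :: "'n \<Rightarrow>\<^sub>0 nat"
  let ?J = "{f :: 'n cpoly. \<forall>m\<in>Poly_Mapping.keys f. P m}"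
  \<comment> \<open>A factor of positive degree lifts the monomial above degree \<open>d\<close>,
    where the condition on weights is void.\<close>
  have "P (k + m)" if "P m" for k m
  proof (cases "mon_degree k = 0")
    case True
    then have "k = 0"
      by (intro poly_mapping_eqI) (simp add: mon_degree_def)
    then show ?thesis
      using that by simp
  qed (use that in \<open>auto simp: P_def\<close>)
  then have mult: "h * f \<in> ?J" if "f \<in> ?J" for f h
    using that keys_mult [of h f] by fastforce
  have add: "f + g \<in> ?J" if "f \<in> ?J" "g \<in> ?J" for f g
    using that keys_add [of f g] by blast
  have "0 \<in> ?J"
    by simp
  then have "ideal ?J poly_ring"
    unfolding ideal_poly_ring_iff by (intro conjI ballI allI add mult)
  moreover have "{f. homogeneous (int d) f \<and> fixed_poly d a f} \<subseteq> ?J"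
    using assms(1) by (auto simp: fixed_poly_iff homogeneous_def P_def)
  ultimately have "fixed_forms_ideal d a \<subseteq> ?J"
    unfolding fixed_forms_ideal_def by (rule genideal_minimal)
  then have "P m"
    using assms by blast
  then show "d \<le> mon_degree m" "mon_degree m = d \<Longrightarrow> d dvd weight a m"
    by (simp_all add: P_def)
qed

lemma fixed_forms_ideal_low_degree:
  assumes "d \<ge> 2" "f \<in> fixed_forms_ideal d a" "homogeneous j f" "j < int d"
  shows "f = 0"
proof (rule ccontr)
  assume "f \<noteq> 0"
  then obtain m where "m \<in> Poly_Mapping.keys f"
    by fastforce
  then show False
    using keys_fixed_forms_ideal(1) [OF assms(1,2)] assms(3,4) by (force simp: homogeneous_def)
qed

lemma norm_in_kernel:
  fixes a :: "'n::finite \<Rightarrow> nat"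
  assumes "d \<ge> 2" "c i \<noteq> 0"
  obtains h where "homogeneous (int d - 1) h" "linear_form c * h \<in> fixed_forms_ideal d a"
    "h \<notin> fixed_forms_ideal d a"
proof -
  define T where "T k = linear_form (\<lambda>i. (prim_root d ^ a i) ^ k * c i)" for k
  obtain e where e: "d = Suc e"
    using assms(1) by (cases d) auto
  \<comment> \<open>The product of the translates \<open>T 1\<close>, ..., \<open>T (d - 1)\<close>;
    the missing one is \<open>T 0\<close>, the form itself.\<close>
  define h where "h = (\<Prod>k<e. T (Suc k))"
  have T0: "T 0 = linear_form c"
    by (simp add: T_def)
  have "(prim_root d ^ a i) ^ d = 1" for i
    using assms(1) by (simp add: prim_root_power_eq_1_iff flip: power_mult)
  then have Td: "T d = linear_form c"
    by (simp add: T_def)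
  have hom_T: "homogeneous 1 (T k)" for k
    by (simp add: T_def homogeneous_linear_form)
  then have hom_h: "homogeneous (int d - 1) h"
    using homogeneous_prod [of "{..<e}" "\<lambda>k. T (Suc k)"] by (simp add: h_def e)
  \<comment> \<open>The generator shifts the translates, and \<open>T d = T 0\<close>, so it
    permutes the factors of the full product cyclically.\<close>
  have "mat_action (diag_rep d a 1) (T k) = T (Suc k)" for k
    unfolding mat_action_diag_rep T_def poly_subst_linear_form
    by (simp add: linear_form_def Const_def mult_single ac_simps)
  then have "mat_action (diag_rep d a 1) (\<Prod>k<d. T k) = (\<Prod>k<d. T (Suc k))"
    unfolding mat_action_def by (simp add: poly_subst_prod)
  moreover have "(\<Prod>k<d. T (Suc k)) = linear_form c * h"
    using Td by (simp add: e h_def mult.commute)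
  moreover have "(\<Prod>k<d. T k) = linear_form c * h"
    unfolding e h_def prod.lessThan_Suc_shift T0 by simp
  ultimately have "mat_action (diag_rep d a 1) (linear_form c * h) = linear_form c * h"
    by simp
  then have "d dvd weight a m" if "m \<in> Poly_Mapping.keys (linear_form c * h)" for m
    using that assms(1) by (intro weight_of_fixed) auto
  moreover have "homogeneous (int d) (linear_form c * h)"
    using homogeneous_mult [OF homogeneous_linear_form hom_h] by simp
  ultimately have "linear_form c * h \<in> fixed_forms_ideal d a"
    using assms(1) by (intro fixed_form_in_ideal)
  moreover have "h \<notin> fixed_forms_ideal d a"
  proof
    assume "h \<in> fixed_forms_ideal d a"
    then have "h = 0"
      using fixed_forms_ideal_low_degree [OF assms(1) _ hom_h] by simp
    \<comment> \<open>At the \<open>i\<close>-th coordinate point each translate takes the value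
      \<open>c i\<close> times a root of unity, so \<open>h\<close> does not vanish there.\<close>
    define p where "p j = (if j = i then 1 else 0 :: complex)" for j
    have "poly_subst (\<lambda>i. Const (p i)) h = Const (\<Prod>k<e. (prim_root d ^ a i) ^ Suc k * c i)"
      unfolding h_def poly_subst_prod T_def eval_linear_form Const_prod
      by (simp add: p_def mult_delta_right)
    moreover have "(\<Prod>k<e. (prim_root d ^ a i) ^ Suc k * c i) \<noteq> 0"
      using assms by (simp add: prim_root_def)
    ultimately show False
      using \<open>h = 0\<close> by simp
  qed
  ultimately show thesis
    using hom_h that by blast
qed

section \<open>Failure of surjectivity\<close>

context
  fixes d :: nat and a :: "'n::finite \<Rightarrow> nat" and c :: "'n \<Rightarrow> complex"
  assumes d: "d \<ge> 2" and a: "\<And>i. a i < d"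
    and onto: "\<And>F. homogeneous (int d) F \<Longrightarrow>
      \<exists>h. homogeneous (int d - 1) h \<and> F - linear_form c * h \<in> fixed_forms_ideal d a"
begin

text \<open>The ideal contains only fixed forms in degree \<open>d\<close>, so on the hyperplane
  every form of degree \<open>d\<close> agrees with a fixed one.\<close>

lemma onto_fixed_form:
  assumes "homogeneous (int d) F"
  obtains h f where "F = linear_form c * h + f" "homogeneous (int d) f"
    "f \<in> fixed_forms_ideal d a" "\<And>m. m \<in> Poly_Mapping.keys f \<Longrightarrow> d dvd weight a m"
proof -
  obtain h where h: "homogeneous (int d - 1) h" "F - linear_form c * h \<in> fixed_forms_ideal d a"
    using onto assms by blast
  have hom: "homogeneous (int d) (F - linear_form c * h)"
    using homogeneous_mult [OF homogeneous_linear_form h(1)] assms by (simp add: homogeneous_diff)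
  then have "d dvd weight a m" if "m \<in> Poly_Mapping.keys (F - linear_form c * h)" for m
    using keys_fixed_forms_ideal(2) [OF d h(2) that] that by (force simp: homogeneous_def)
  then show thesis
    using that [of h "F - linear_form c * h"] hom h by simp
qed

text \<open>The point \<open>p\<close> and its translate \<open>q\<close> lie on the hyperplane. A
  fixed form has equal values at both, while the power \<open>lam ^ d\<close> vanishes at
  \<open>p\<close> only.\<close>

lemma onto_no_translate_pair:
  assumes "(\<Sum>l\<in>UNIV. c l * p l) = 0" "(\<Sum>l\<in>UNIV. c l * (prim_root d ^ a l * p l)) = 0"
    and "p i \<noteq> 0" "p j \<noteq> 0" "a i \<noteq> a j"
  shows False
proof -
  define ev where "ev p = (poly_subst (\<lambda>i. Const (p i)) :: 'n cpoly \<Rightarrow> _)" for p :: "'n \<Rightarrow> complex"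
  define q where "q l = prim_root d ^ a l * p l" for l
  \<comment> \<open>This is \<open>p j\<close> times the \<open>i\<close>-th variable minus
    \<open>p i\<close> times the \<open>j\<close>-th. At \<open>q\<close> its value is
    \<open>p i * p j * (prim_root d ^ a i - prim_root d ^ a j)\<close>.\<close>
  define lam where "lam = linear_form (\<lambda>l. (if l = i then p j else 0) + (if l = j then - p i else 0))"
  have "homogeneous (int d) (lam ^ d)"
    unfolding lam_def by (intro homogeneous_power homogeneous_linear_form)
  then obtain h f where hf: "lam ^ d = linear_form c * h + f"
    "\<And>m. m \<in> Poly_Mapping.keys f \<Longrightarrow> d dvd weight a m"
    by (rule onto_fixed_form) blast
  have "ev q f = ev p f"
    unfolding ev_def poly_subst_def
  proof (rule sum.cong)
    fix m assume "m \<in> Poly_Mapping.keys f"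
    then have "(\<Prod>i\<in>UNIV. (prim_root d ^ a i) ^ Poly_Mapping.lookup m i) = 1"
      using hf(2) d prod_prim_root_powers [of d a 1 m] by (simp add: prim_root_power_eq_1_iff)
    then have "(\<Prod>i\<in>UNIV. q i ^ Poly_Mapping.lookup m i) = (\<Prod>i\<in>UNIV. p i ^ Poly_Mapping.lookup m i)"
      by (simp add: q_def power_mult_distrib prod.distrib)
    then show "Const (Poly_Mapping.lookup f m) * (\<Prod>i\<in>UNIV. Const (q i) ^ Poly_Mapping.lookup m i) =
      Const (Poly_Mapping.lookup f m) * (\<Prod>i\<in>UNIV. Const (p i) ^ Poly_Mapping.lookup m i)"
      by (simp flip: Const_power Const_prod)
  qed simp
  moreover have "ev r (lam ^ d) = ev r f" if "(\<Sum>l\<in>UNIV. c l * r l) = 0" for r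
    unfolding hf(1) ev_def poly_subst_add poly_subst_mult eval_linear_form that by simp
  ultimately have "ev q (lam ^ d) = ev p (lam ^ d)"
    using assms(1,2) by (simp add: q_def)
  moreover have "ev r (lam ^ d) = Const ((p j * r i - p i * r j) ^ d)" for r
    unfolding ev_def lam_def poly_subst_power eval_linear_form Const_power
    by (simp add: mult_delta_left sum.distrib distrib_right)
  ultimately have "Const ((p j * q i - p i * q j) ^ d) = (Const ((p j * p i - p i * p j) ^ d) :: 'n cpoly)"
    by simp
  also have "\<dots> = 0"
    using d by (simp add: mult.commute power_0_left)
  finally have "(p j * q i - p i * q j) ^ d = 0"
    by simp
  then have "p i * p j * (prim_root d ^ a i - prim_root d ^ a j) = 0"
    by (simp add: q_def algebra_simps)
  moreover have "prim_root d ^ a i \<noteq> prim_root d ^ a j"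
    using d a assms(5) by (simp add: prim_root_power_eq_iff)
  ultimately show False
    using assms by simp
qed

text \<open>Here the \<open>k\<close>-th coordinate point lies on the hyperplane and is fixed by the action. The fixed
  forms have derivative zero at this point in all directions with weight different from \<open>a k\<close>.\<close>

lemma onto_no_fixed_point:
  assumes "c k = 0" "c i \<noteq> 0" "i \<noteq> j" "a i \<noteq> a k" "a j \<noteq> a k"
  shows False
proof -
  \<comment> \<open>For \<open>l\<close> other than \<open>k\<close>, the coefficient at
    \<open>M l\<close> of a form of degree \<open>d\<close> is its derivative in direction
    \<open>l\<close> at the \<open>k\<close>-th coordinate point.\<close>
  define M where "M l = Poly_Mapping.single l 1 + Poly_Mapping.single k (d - 1)" for l
  have "mon_degree (M j) = d"
    using d by (simp add: M_def)
  then have "homogeneous (int d) (Poly_Mapping.single (M j) 1)"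
    by (simp add: homogeneous_single)
  then obtain h f where hf: "Poly_Mapping.single (M j) 1 = linear_form c * h + f"
    "\<And>m. m \<in> Poly_Mapping.keys f \<Longrightarrow> d dvd weight a m"
    by (rule onto_fixed_form) blast
  let ?H = "Poly_Mapping.lookup h (Poly_Mapping.single k (d - 1))"
  have lookup: "Poly_Mapping.lookup (Poly_Mapping.single (M j) 1) (M l) = c l * ?H"
    if "a l \<noteq> a k" for l
  proof -
    \<comment> \<open>Adding \<open>a k\<close> avoids truncated subtraction: the weight is
      congruent to \<open>a l - a k\<close> modulo \<open>d\<close>, hence nonzero there.\<close>
    have "weight a (M l) + a k = a l + a k * d"
      using d by (cases d) (simp_all add: M_def)
    then have "\<not> d dvd weight a (M l)"
      using a [of k] a [of l] that
      by (metis mod_less mod_mult_self1 mod_add_left_eq dvd_imp_mod_0 add_0 mult.commute)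
    then have "Poly_Mapping.lookup f (M l) = 0"
      using hf(2) by (auto simp: in_keys_iff)
    moreover have "Poly_Mapping.lookup (Poly_Mapping.single (Poly_Mapping.single x 1) (c x) * h) (M l) =
      (if x = l then c l * ?H else 0)" for x
    proof (cases "x = l \<or> x = k")
      case True
      then show ?thesis
        using assms(1) lookup_single_mult [of "Poly_Mapping.single l 1" "c l" h] that
        by (auto simp: M_def)
    next
      case False
      then have "Poly_Mapping.lookup (M l) x = 0"
        by (auto simp: M_def lookup_add lookup_single when_def)
      then have "M l \<noteq> Poly_Mapping.single x 1 + m" for m
        by (auto simp: lookup_add)
      then show ?thesis
        using False by (simp add: lookup_single_mult_0)
    qed
    ultimately show ?thesis
      unfolding hf(1) by (simp add: linear_form_def sum_distrib_right lookup_add lookup_sum)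
  qed
  have "M i \<noteq> M j"
    using assms(3) by (simp add: M_def)
  \<comment> \<open>The index \<open>i\<close> forces \<open>?H = 0\<close>, whereas the chosen
    monomial \<open>M j\<close> requires \<open>c j * ?H = 1\<close>.\<close>
  then have "c i * ?H = 0"
    using lookup [of i] assms(4) by (simp add: lookup_single)
  moreover have "c j * ?H = 1"
    using lookup [of j] assms(5) by simp
  ultimately show False
    using assms(2) by simp
qed

text \<open>If \<open>c i\<close> vanishes too, the hyperplane contains the line through the
  \<open>i\<close>-th and \<open>k\<close>-th coordinate points, and their sum gives a translate
  pair. Otherwise the \<open>k\<close>-th coordinate point gives the contradiction.\<close>

lemma onto_no_zero_coefficient:
  assumes "a i \<noteq> a j" "a i \<noteq> a k" "a j \<noteq> a k" "c k = 0"
  shows False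
proof (cases "c i = 0")
  case True
  show False
    by (rule onto_no_translate_pair
        [where p = "\<lambda>l. (if l = i then 1 else 0) + (if l = k then 1 else 0)" and i = i and j = k])
      (use assms True in \<open>auto simp: distrib_left mult_delta_right sum.distrib\<close>)
next
  case False
  then show False
    using onto_no_fixed_point [of k i j] assms by metis
qed

lemma onto_no_three_values:
  assumes "a i \<noteq> a j" "a i \<noteq> a k" "a j \<noteq> a k"
  shows False
proof -
  have nz: "c i \<noteq> 0" "c j \<noteq> 0" "c k \<noteq> 0"
    using assms onto_no_zero_coefficient by metis+
  let ?w = "\<lambda>l. prim_root d ^ a l"
  have w: "?w i \<noteq> ?w j" "?w i \<noteq> ?w k" "?w j \<noteq> ?w k"
    using assms d a by (simp_all add: prim_root_power_eq_iff)
  have ne: "i \<noteq> j" "i \<noteq> k" "j \<noteq> k"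
    using assms by auto
  show False
    by (rule onto_no_translate_pair
        \<comment> \<open>On the three coordinates this is the cross product of the vectors with
          entries \<open>c l\<close> and \<open>c l * ?w l\<close>, hence orthogonal to both. Its
          entries are nonzero by \<open>nz\<close> and \<open>w\<close>.\<close>
        [where p = "\<lambda>l. (if l = i then c j * c k * (?w k - ?w j) else 0) +
           ((if l = j then c i * c k * (?w i - ?w k) else 0) +
            (if l = k then c i * c j * (?w j - ?w i) else 0))" and i = i and j = j])
      (use assms nz w ne in
        \<open>simp_all add: distrib_left mult_delta_right sum.distrib, simp_all add: algebra_simps\<close>)
qed

text \<open>On each pair of coordinates there is a nonzero vector killed by \<open>c\<close>. The
  generator only rescales the two vectors, so their sum and its translate both lie on the
  hyperplane.\<close>

lemma onto_no_two_pairs: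
  assumes "i \<noteq> i'" "j \<noteq> j'" "a i = a i'" "a j = a j'" "a i \<noteq> a j"
  shows False
proof -
  have kernel: "\<exists>u v. x * u + y * v = 0 \<and> (u \<noteq> 0 \<or> v \<noteq> 0)" for x y :: complex
  proof (cases "x = 0")
    case False
    then show ?thesis
      by (intro exI [of _ "y / x"] exI [of _ "-1"]) simp
  qed auto
  obtain u u' where u: "c i * u + c i' * u' = 0" "u \<noteq> 0 \<or> u' \<noteq> 0"
    using kernel by blast
  obtain v v' where v: "c j * v + c j' * v' = 0" "v \<noteq> 0 \<or> v' \<noteq> 0"
    using kernel by blast
  define p where "p l = (if l = i then u else 0) + ((if l = i' then u' else 0) +
    ((if l = j then v else 0) + (if l = j' then v' else 0)))" for l
  have ne: "i \<noteq> j" "i \<noteq> j'" "i' \<noteq> j" "i' \<noteq> j'"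
    using assms by auto
  \<comment> \<open>One of \<open>u\<close>, \<open>u'\<close> may be zero, so the nonzero entry has
    to be selected from the pair.\<close>
  obtain x where x: "p x \<noteq> 0" "a x = a i"
    using u(2) assms ne that [of i] that [of i'] by (auto simp: p_def)
  obtain y where y: "p y \<noteq> 0" "a y = a j"
    using v(2) assms ne that [of j] that [of j'] by (auto simp: p_def)
  have "(\<Sum>l\<in>UNIV. c l * p l) = (c i * u + c i' * u') + (c j * v + c j' * v')"
    by (simp add: p_def distrib_left mult_delta_right sum.distrib)
  moreover have "(\<Sum>l\<in>UNIV. c l * (prim_root d ^ a l * p l)) =
    prim_root d ^ a i * (c i * u + c i' * u') + prim_root d ^ a j * (c j * v + c j' * v')"
    using assms(3,4)
    by (simp add: p_def distrib_left mult_delta_right sum.distrib)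
  ultimately show False
    using onto_no_translate_pair [of p x y] u v x y assms(5) by simp
qed

end

text \<open>Every value is avoided by at least two indices. Take \<open>j\<close>, \<open>j'\<close>
  avoiding the value \<open>a i\<close>, then \<open>x\<close>, \<open>y\<close> avoiding
  \<open>a j\<close>. Either both pairs are constant, or one that is not gives three values together
  with \<open>i\<close> or \<open>j\<close>.\<close>

lemma three_values_or_two_pairs:
  fixes a :: "'n::finite \<Rightarrow> nat"
  assumes "\<not> (\<exists>v. card {i. a i = v} \<ge> CARD('n) - 1)"
  obtains i j k where "a i \<noteq> a j" "a i \<noteq> a k" "a j \<noteq> a k"
    | i i' j j' where "i \<noteq> i'" "j \<noteq> j'" "a i = a i'" "a j = a j'" "a i \<noteq> a j"
proof -
  have two: "\<exists>x y. x \<noteq> y \<and> a x \<noteq> v \<and> a y \<noteq> v" for v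
  proof (rule ccontr)
    assume "\<not> ?thesis"
    then have "card (- {i. a i = v}) \<le> 1"
      by (intro card_le_Suc0_iff_eq [THEN iffD2, folded One_nat_def]) auto
    then have "card {i. a i = v} \<ge> CARD('n) - 1"
      by (simp add: Compl_eq_Diff_UNIV card_Diff_subset)
    then show False
      using assms by blast
  qed
  obtain i where "a i \<noteq> 0"
    using two by blast
  obtain j j' where j: "j \<noteq> j'" "a j \<noteq> a i" "a j' \<noteq> a i"
    using two by blast
  obtain x y where x: "x \<noteq> y" "a x \<noteq> a j" "a y \<noteq> a j"
    using two by blast
  show thesis
  proof (cases "a j = a j' \<and> a x = a y")
    case True
    then show thesis
      using that(2) [of x y j j'] j x by auto
  next
    case False
    then show thesis
      using that(1) j x by metis
  qed
qed

section \<open>The case of at least \<open>n - 1\<close> equal weights\<close>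

text \<open>In degree \<open>d\<close> such a monomial has weight \<open>v * d\<close> and is fixed.
  Those of higher degree are multiples of these, by induction on the excess degree.\<close>

lemma monomial_in_fixed_forms_ideal:
  fixes a :: "'n::finite \<Rightarrow> nat"
  assumes "d \<ge> 2" "\<And>i. i \<noteq> i0 \<Longrightarrow> a i = v"
  shows "Poly_Mapping.lookup m i0 = 0 \<Longrightarrow> d \<le> mon_degree m \<Longrightarrow>
    Poly_Mapping.single m c \<in> fixed_forms_ideal d a"
proof (induction "mon_degree m - d" arbitrary: m)
  case 0
  have "weight a m = (\<Sum>i\<in>UNIV. v * Poly_Mapping.lookup m i)"
    unfolding weight_def
  proof (rule sum.cong)
    show "a i * Poly_Mapping.lookup m i = v * Poly_Mapping.lookup m i" for i
      using assms(2) [of i] 0 by (cases "i = i0") simp_all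
  qed simp
  also have "\<dots> = v * d"
    using 0 by (simp add: mon_degree_def flip: sum_distrib_left)
  finally show ?case
    using assms(1) 0 by (intro fixed_form_in_ideal homogeneous_single) (auto split: if_splits)
next
  case (Suc k)
  obtain i m' where m: "m = Poly_Mapping.single i 1 + m'"
    using Suc.hyps(2) by (metis monomial_split_degree diff_is_0_eq nat.distinct(1) not_gr_zero zero_le)
  have "Poly_Mapping.single m' c \<in> fixed_forms_ideal d a"
    using Suc m by (intro Suc.hyps(1)) (auto simp: lookup_add)
  then have "Poly_Mapping.single (Poly_Mapping.single i 1) 1 * Poly_Mapping.single m' c
      \<in> fixed_forms_ideal d a"
    using fixed_forms_ideal_ideal [of d a] unfolding ideal_poly_ring_iff by blast
  then show ?case
    by (simp add: m mult_single)
qed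

lemma weak_Lefschetz_of_equal_weights:
  fixes a :: "'n::finite \<Rightarrow> nat"
  assumes "d \<ge> 2" "\<And>i. i \<noteq> i0 \<Longrightarrow> a i = v"
  shows "weak_Lefschetz (fixed_forms_ideal d a)"
proof -
  let ?I = "fixed_forms_ideal d a"
  define x :: "'n cpoly" where "x = Poly_Mapping.single (Poly_Mapping.single i0 1) 1"
  have hom_x: "homogeneous 1 x"
    by (simp add: x_def homogeneous_single)
  note ideal = fixed_forms_ideal_ideal [of d a]
  \<comment> \<open>Here \<open>x * f\<close> has degree below \<open>d\<close>, where the ideal is
    zero, and \<open>x\<close> is not a zero divisor.\<close>
  have injective: "f \<in> ?I" if "homogeneous j f" "x * f \<in> ?I" "j < int d - 1" for f j
  proof -
    have "x * f = 0"
      using fixed_forms_ideal_low_degree [OF assms(1) that(2)] homogeneous_mult [OF hom_x that(1)] that(3)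
      by simp
    then have "Poly_Mapping.lookup f m = 0" for m
      using lookup_single_mult [of "Poly_Mapping.single i0 1" 1 f m] by (simp add: x_def)
    then have "f = 0"
      by (simp add: poly_mapping_eqI)
    then show ?thesis
      using ideal by (simp add: ideal_poly_ring_iff)
  qed
  have surjective: "\<exists>h. homogeneous j h \<and> F - x * h \<in> ?I"
    if F: "homogeneous (j + 1) F" "j \<ge> int d - 1" for F j
  proof -
    \<comment> \<open>A monomial of degree at least \<open>d\<close> either avoids \<open>x\<close>
      and lies in the ideal, or is divisible by \<open>x\<close>.\<close>
    have "\<exists>h. homogeneous j h \<and> Poly_Mapping.single m c - x * h \<in> ?I"
      if m: "m \<in> Poly_Mapping.keys F" for m c
    proof (cases "Poly_Mapping.lookup m i0 = 0")
      case True
      then have "Poly_Mapping.single m c \<in> ?I"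
        using F m assms by (intro monomial_in_fixed_forms_ideal) (auto simp: homogeneous_def)
      then show ?thesis
        by (intro exI [of _ 0]) simp
    next
      case False
      then obtain m' where m': "m = Poly_Mapping.single i0 1 + m'"
        by (rule monomial_split)
      then have "homogeneous j (Poly_Mapping.single m' c)"
        using F(1) m by (intro homogeneous_single) (force simp: homogeneous_def)
      then show ?thesis
        using ideal m' by (intro exI [of _ "Poly_Mapping.single m' c"])
          (simp add: x_def mult_single ideal_poly_ring_iff)
    qed
    then obtain h where h: "\<And>m c. m \<in> Poly_Mapping.keys F \<Longrightarrow>
      homogeneous j (h m c) \<and> Poly_Mapping.single m c - x * h m c \<in> ?I"
      by metis
    let ?h = "\<Sum>m\<in>Poly_Mapping.keys F. h m (Poly_Mapping.lookup F m)"
    have "F - x * ?h = (\<Sum>m\<in>Poly_Mapping.keys F.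
      Poly_Mapping.single m (Poly_Mapping.lookup F m) - x * h m (Poly_Mapping.lookup F m))"
      by (simp add: sum_subtractf sum_monomials sum_distrib_left)
    then have "F - x * ?h \<in> ?I"
      using h by (simp add: ideal_sum [OF ideal])
    moreover have "homogeneous j ?h"
      using h by (intro homogeneous_sum) blast
    ultimately show ?thesis
      by blast
  qed
  show ?thesis
    unfolding weak_Lefschetz_iff [OF ideal]
    using hom_x injective surjective by (metis linorder_not_le)
qed

theorem theorem7p8:
  fixes d :: nat and a :: "'n::finite \<Rightarrow> nat"
  assumes "d \<ge> 2" and "CARD('n) \<ge> 3" and "\<forall>i. a i \<le> d - 1"
  shows "weak_Lefschetz (fixed_forms_ideal d a) \<longleftrightarrow>
         (\<exists>c. card {i. a i = c} \<ge> CARD('n) - 1)"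
proof
  assume "\<exists>c. card {i. a i = c} \<ge> CARD('n) - 1"
  then obtain v where "card {i. a i = v} \<ge> CARD('n) - 1" ..
  then have "card (- {i. a i = v}) \<le> Suc 0"
    by (simp add: Compl_eq_Diff_UNIV card_Diff_subset)
  then have "\<forall>i\<in>- {i. a i = v}. \<forall>j\<in>- {i. a i = v}. i = j"
    by (simp add: card_le_Suc0_iff_eq)
  \<comment> \<open>If all weights equal \<open>v\<close>, any index serves as
    \<open>i0\<close>.\<close>
  then obtain i0 where "\<And>i. i \<noteq> i0 \<Longrightarrow> a i = v"
    by (metis ComplI mem_Collect_eq)
  then show "weak_Lefschetz (fixed_forms_ideal d a)"
    using weak_Lefschetz_of_equal_weights assms(1) by blast
next
  let ?I = "fixed_forms_ideal d a"
  assume "weak_Lefschetz ?I"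
  then obtain L where L: "homogeneous 1 L" and wlp:
    "\<And>j. (\<forall>f. homogeneous j f \<longrightarrow> L * f \<in> ?I \<longrightarrow> f \<in> ?I) \<or>
          (\<forall>F. homogeneous (j + 1) F \<longrightarrow> (\<exists>h. homogeneous j h \<and> F - L * h \<in> ?I))"
    unfolding weak_Lefschetz_iff [OF fixed_forms_ideal_ideal] by blast
  obtain c where c: "L = linear_form c"
    using L by (rule linear_form_exists)
  \<comment> \<open>The zero form fails from degree 0 to degree 1: since \<open>d\<close> is at
    least 2, neither 1 nor a variable lies in the ideal, so the zero map is neither injective nor
    surjective there.\<close>
  have "\<exists>i. c i \<noteq> 0"
  proof (rule ccontr)
    assume "\<not> ?thesis"
    then have "L = 0"
      by (simp add: c linear_form_eq_0)
    have low: "f \<notin> ?I" if "f \<noteq> 0" "homogeneous j f" "j \<le> 1" for f j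
      using fixed_forms_ideal_low_degree [OF assms(1) _ that(2)] that assms(1) by auto
    have zero: "0 \<in> ?I"
      using fixed_forms_ideal_ideal [of d a] by (simp add: ideal_poly_ring_iff)
    let ?x = "Poly_Mapping.single (Poly_Mapping.single undefined 1) 1 :: 'n cpoly"
    have "homogeneous 1 ?x" "?x \<noteq> 0"
      by (simp_all add: homogeneous_single flip: keys_eq_empty)
    then have "?x \<notin> ?I"
      using low by blast
    moreover have "(1 :: 'n cpoly) \<notin> ?I"
      using low [of 1 0] by simp
    ultimately show False
      using wlp [of 0] \<open>L = 0\<close> zero \<open>homogeneous 1 ?x\<close> homogeneous_one by auto
  qed
  then obtain h where "homogeneous (int d - 1) h" "L * h \<in> ?I" "h \<notin> ?I"
    unfolding c using norm_in_kernel assms(1) by metis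
  \<comment> \<open>The kernel element \<open>h\<close> rules out injectivity in degree
    \<open>d - 1\<close>, leaving the surjective alternative.\<close>
  then have onto: "\<exists>h. homogeneous (int d - 1) h \<and> F - linear_form c * h \<in> ?I"
    if "homogeneous (int d) F" for F
    using wlp [of "int d - 1"] that c by auto
  have a: "a i < d" for i
    using assms(1) spec [OF assms(3), of i] by linarith
  show "\<exists>c. card {i. a i = c} \<ge> CARD('n) - 1"
  proof (rule ccontr)
    assume "\<not> ?thesis"
    then show False
    proof (rule three_values_or_two_pairs)
      fix i j k assume "a i \<noteq> a j" "a i \<noteq> a k" "a j \<noteq> a k"
      then show False
        using onto_no_three_values [where d = d and a = a and c = c, OF assms(1) a onto] by metis
    next
      fix i i' j j' assume "i \<noteq> i'" "j \<noteq> j'" "a i = a i'" "a j = a j'" "a i \<noteq> a j"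
      then show False
        using onto_no_two_pairs [where d = d and a = a and c = c, OF assms(1) a onto] by metis
    qed
  qed
qed

end
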